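(* Let $K$ be an infinite field with $\mathrm{char}(K)\neq 2$, and for $n\ge 2$ set $K^n=\{k^n : k\in K\}$. (1) We have $K\in\mathcal{N}_{2,2}$ if and only if $K\neq K^2$, and $K\in\mathcal{N}_{2,2}^\infty$ if and only if $K\setminus K^2$ is infinite. (2) We have $K\in\mathcal{N}_{2,3}^\infty$ if at least one of the following holds: (a) $-1\notin K^2$ and $K$ has a discrete valuation $v$ with $v(5)$ odd; or (b) $K$ is a totally real number field and there is a prime of residue degree $1$ of its ring of integers lying over $(3)$. (3) We have $K\in\mathcal{N}_{3,2}^\infty$ if $\mathrm{char}(K)\neq 3$ and $2\notin K^3$. (4) We have $K\in\mathcal{N}_{4,2}^\infty$ if $\mathrm{char}(K)\neq 3$, $3\notin K^2$, and $-3\notin K^4$. (5) We have $K\in\mathcal{N}_{d,2}^\infty$ for all integers $d\ge 2$ with $d\equiv 2\pmod 4$ if $-1\notin K^2$ and $K$ has a non-trivial discrete valuation.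
   Context: For a polynomial $f\in K[x]$, $f^i$ denotes the $i$-th iterate of $f$ under composition. For $n\ge 2$, $f$ has a newly reducible $n$th iterate over $K$ if $f^{n-1}$ is irreducible over $K$ but $f^n$ is not irreducible over $K$. For integers $d,n\ge 2$, write $K\in\mathcal{N}_{d,n}$ (resp. $K\in\mathcal{N}_{d,n}^\infty$) if there exists at least one (resp. there exist infinitely many) $f\in K[x]$ of degree $d$ with newly reducible $n$th iterate over $K$. Discrete valuations are maps $v:K^*\to\mathbb{Z}$; the condition that $v(5)$ is odd includes $5\neq 0$ in $K$. *)

theory Defs
  imports
    "HOL-Computational_Algebra.Computational_Algebra"
    "HOL-Algebra.QuotRing"
    "HOL-Algebra.Embedded_Algebras"
    "HOL-Algebra.Algebraic_Closure_Type"
begin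

hide_const (open) Divisibility.irreducible Polynomials.degree

definition nth_powers :: "nat \<Rightarrow> 'a :: field set" where
  "nth_powers n = range (\<lambda>k. k ^ n)"

definition iterate :: "'a :: field poly \<Rightarrow> nat \<Rightarrow> 'a poly" where
  "iterate f n = (pcompose f ^^ n) [:0, 1:]"

definition newly_reducible :: "'a :: field poly \<Rightarrow> nat \<Rightarrow> bool" where
  "newly_reducible f n \<longleftrightarrow>
     n \<ge> 2 \<and> Factorial_Ring.irreducible (iterate f (n - 1)) \<and>
     \<not> Factorial_Ring.irreducible (iterate f n)"

text \<open>
  The classes $\mathcal{N}_{d,n}$ and $\mathcal{N}_{d,n}^\infty$ are predicates of the
  field, which is a type here. They are meant for $d, n \ge 2$.
\<close>

definition in_N :: "nat \<Rightarrow> nat \<Rightarrow> 'a :: field itself \<Rightarrow> bool" where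
  "in_N d n K \<longleftrightarrow> (\<exists>f :: 'a poly. Polynomial.degree f = d \<and> newly_reducible f n)"

definition in_N_infinite :: "nat \<Rightarrow> nat \<Rightarrow> 'a :: field itself \<Rightarrow> bool" where
  "in_N_infinite d n K \<longleftrightarrow>
     infinite {f :: 'a poly. Polynomial.degree f = d \<and> newly_reducible f n}"

text \<open>
  Only the values of \<open>v\<close> at nonzero elements matter; the value at \<open>0\<close> is junk. The valuation
  need not be surjective, and the zero map is the trivial valuation.
\<close>

definition discrete_valuation :: "('a :: field \<Rightarrow> int) \<Rightarrow> bool" where
  "discrete_valuation v \<longleftrightarrow>
     (\<forall>x y. x \<noteq> 0 \<longrightarrow> y \<noteq> 0 \<longrightarrow> v (x * y) = v x + v y) \<and>
     (\<forall>x y. x \<noteq> 0 \<longrightarrow> y \<noteq> 0 \<longrightarrow> x + y \<noteq> 0 \<longrightarrow> v (x + y) \<ge> min (v x) (v y))"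

definition nontrivial_valuation :: "('a :: field \<Rightarrow> int) \<Rightarrow> bool" where
  "nontrivial_valuation v \<longleftrightarrow> (\<exists>x. x \<noteq> 0 \<and> v x \<noteq> 0)"

text \<open>
  The constant \<open>\<rat>\<close> of the library requires the class \<open>field_char_0\<close>, so the copy of
  the rationals in a field of characteristic zero is spelt out.
\<close>

definition rationals :: "'a :: field set" where
  "rationals = {of_int a / of_int b | a b. b \<noteq> 0}"

definition number_field :: "'a :: field itself \<Rightarrow> bool" where
  "number_field K \<longleftrightarrow> CHAR('a) = 0 \<and>
     (\<exists>n. ring.dimension (ring_of_type_algebra :: 'a ring) n rationals UNIV)"

definition totally_real :: "'a :: field itself \<Rightarrow> bool" where
  "totally_real K \<longleftrightarrow>
     (\<forall>\<sigma> \<in> ring_hom (ring_of_type_algebra :: 'a ring) (ring_of_type_algebra :: complex ring).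
        range \<sigma> \<subseteq> \<real>)"

definition ring_of_integers :: "'a :: field ring" where
  "ring_of_integers = ring_of_type_algebra\<lparr>carrier := {x. algebraic_int x}\<rparr>"

definition lies_over :: "'a :: field set \<Rightarrow> nat \<Rightarrow> bool" where
  "lies_over P p \<longleftrightarrow> (\<forall>m :: int. of_int m \<in> P \<longleftrightarrow> int p dvd m)"

text \<open>
  For a prime \<open>P\<close> over \<open>(p)\<close>, the image of the integers in the residue field is the field
  with \<open>p\<close> elements, over which the dimension is taken.
\<close>

definition residue_degree :: "'a :: field set \<Rightarrow> nat \<Rightarrow> bool" where
  "residue_degree P f \<longleftrightarrow>
     (let F = ring_of_integers Quot P
      in ring.dimension F f (range (\<lambda>m :: int. P +>\<^bsub>ring_of_integers\<^esub> of_int m)) (carrier F))"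

end

theory Submission
  imports Defs
begin

text \<open>
  One polynomial is enough for each existence claim. Conjugating \<open>f\<close> by \<open>x \<mapsto> c x\<close> gives
  \<open>c f(x / c)\<close>, whose iterates are the conjugates of the iterates of \<open>f\<close>; as the conjugation
  fixes \<open>0\<close>, it preserves irreducibility. It multiplies the leading coefficient by \<open>c ^ (1 - d)\<close>, so
  over an infinite field and for \<open>d \<ge> 2\<close> the conjugates form an infinite set
  (\<open>in_N_infiniteI\<close>).

  The examples are written as \<open>f(x) = h(x - r)\<close>. In the variable \<open>z = x - r\<close> the iterates of \<open>f\<close>
  become \<open>h\<close>, \<open>h(h - r)\<close>, \<open>h(h(h - r) - r)\<close>, and so on (\<open>newly_reducible_translate\<close>), which makes
  \<open>h\<close> a two-term polynomial in all cases. Let \<open>\<alpha>\<close> be a root of an irreducible iterate. The next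
  iterate is reducible as soon as \<open>f(x) - \<alpha>\<close> is reducible over \<open>K(\<alpha>)\<close>, and \<open>h\<close> and \<open>r\<close> are
  chosen to make this happen:

  \<^item> Degree 2, second iterate: \<open>f = x^2 + c\<close>. The factorization
    \<open>f(f(x)) = (x^2 + a x + b) (x^2 - a x + b)\<close> forces \<open>c = a^4 / (4 (1 - a^2))\<close>, and \<open>f\<close> is
    irreducible if and only if \<open>a \<noteq> 0\<close> and \<open>a^2 - 1\<close> is not a square. If some element is not a
    square, the parametrization of a conic provides such an \<open>a\<close>.

  \<^item> Degree 2, third iterate: \<open>f = (x - 5)^2 + 4\<close>. The second iterate is \<open>(z^2 - 1)^2 + 4\<close>, which is
    irreducible if \<open>-1\<close> and \<open>5\<close> are not squares, and the third one is
    \<open>(z^4 + 2)^2 - (2 z^3)^2\<close>. If \<open>v(5)\<close> is odd, then \<open>5\<close> is not a square. If there is a prime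
    over \<open>3\<close> with residue field of \<open>3\<close> elements, then no integer congruent to \<open>2\<close> modulo \<open>3\<close> is
    a square, and both \<open>-1\<close> and \<open>5\<close> are such integers.

  \<^item> Degrees 3 and 4: with \<open>\<theta>^3 = 2\<close>, the element \<open>9 (\<theta> - 1)\<close> is a cube in \<open>K(\<theta>)\<close>; with
    \<open>\<theta>^4 = 12\<close>, the element \<open>7 - 2 \<theta>\<close> is a square in \<open>K(\<theta>)\<close>.

  \<^item> Degree \<open>2 m\<close> with \<open>m\<close> odd: \<open>h = (z^(2 m) + 4 c^4) / (4 c^2)\<close> and \<open>r = c^2\<close>. The second iterate
    is a multiple of \<open>A^4 + 4 c^4\<close> for a polynomial \<open>A\<close>, hence factors by the identity of Sophie
    Germain. A suitable valuation of \<open>c\<close> and \<open>-1\<close> not being a square make \<open>h\<close> irreducible.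
\<close>

section \<open>Irreducible polynomials over a field\<close>

lemma not_irreducible_mult:
  fixes g h :: "'a :: field poly"
  assumes "Polynomial.degree g > 0" "Polynomial.degree h > 0"
  shows "\<not> Factorial_Ring.irreducible (g * h)"
  using assms by (metis Factorial_Ring.irreducibleD degree_0 is_unit_iff_degree less_numeral_extra(3))

lemma reducible_poly_monic_divisor:
  fixes p :: "'a :: field poly"
  assumes "Polynomial.degree p > 0" "\<not> Factorial_Ring.irreducible p"
  obtains g where "lead_coeff g = 1" "Polynomial.degree g > 0"
    "2 * Polynomial.degree g \<le> Polynomial.degree p" "g dvd p"
proof -
  have nz: "p \<noteq> 0" using assms(1) by auto
  hence nu: "\<not> p dvd 1" using assms(1) by (simp add: is_unit_iff_degree)
  with nz obtain a b where ab: "p = a * b" "\<not> a dvd 1" "\<not> b dvd 1"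
    using assms(2) unfolding Factorial_Ring.irreducible_def by blast
  have nz': "a \<noteq> 0" "b \<noteq> 0" using nz ab by auto
  have deg: "Polynomial.degree a > 0" "Polynomial.degree b > 0"
    using ab nz' by (auto simp: is_unit_iff_degree)
  have sum: "Polynomial.degree p = Polynomial.degree a + Polynomial.degree b"
    using ab nz' by (simp add: degree_mult_eq)
  define g where "g = (if Polynomial.degree a \<le> Polynomial.degree b then a else b)"
  have g: "g \<noteq> 0" "g dvd p" "Polynomial.degree g > 0" "2 * Polynomial.degree g \<le> Polynomial.degree p"
    using nz' ab deg sum by (auto simp: g_def)
  show thesis
    by (rule that[of "smult (inverse (lead_coeff g)) g"]) (use g in \<open>auto simp: smult_dvd_iff\<close>)
qed

lemma monic_degree_1:
  assumes "lead_coeff g = 1" "Polynomial.degree g = 1"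
  shows "g = [:coeff g 0, 1:]"
  using assms by (intro poly_eqI) (auto simp: coeff_pCons coeff_eq_0 split: nat.splits)

lemma monic_degree_2:
  assumes "lead_coeff g = 1" "Polynomial.degree g = 2"
  shows "g = [:coeff g 0, coeff g 1, 1:]"
  using assms by (intro poly_eqI) (auto simp: coeff_pCons coeff_eq_0 numeral_2_eq_2 split: nat.splits)

lemma irreducible_if_no_root:
  fixes p :: "'a :: field poly"
  assumes "Polynomial.degree p > 1" "Polynomial.degree p \<le> 3" "\<And>x. poly p x \<noteq> 0"
  shows "Factorial_Ring.irreducible p"
proof (rule ccontr)
  assume "\<not> Factorial_Ring.irreducible p"
  moreover have "Polynomial.degree p > 0" using assms(1) by simp
  ultimately obtain g where g: "lead_coeff g = 1" "Polynomial.degree g > 0"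
    "2 * Polynomial.degree g \<le> Polynomial.degree p" "g dvd p"
    by (metis reducible_poly_monic_divisor)
  hence "Polynomial.degree g = 1" using assms(2) by simp
  with g(1) have "g = [:coeff g 0, 1:]" by (rule monic_degree_1)
  hence "poly p (- coeff g 0) = 0" using g(4) by (metis minus_minus poly_eq_0_iff_dvd)
  with assms(3) show False by blast
qed

lemma irreducible_pcompose_linear:
  fixes p :: "'a :: field poly"
  assumes "b \<noteq> 0"
  shows "Factorial_Ring.irreducible (pcompose p [:a, b:]) \<longleftrightarrow> Factorial_Ring.irreducible p"
proof -
  have *: "Factorial_Ring.irreducible p"
    if irr: "Factorial_Ring.irreducible (pcompose p [:a, b:])" and "b \<noteq> 0" for p and a b :: 'a
  proof (rule ccontr)
    assume nirr: "\<not> Factorial_Ring.irreducible p"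
    have deg: "Polynomial.degree (pcompose q [:a, b:]) = Polynomial.degree q" for q
      using \<open>b \<noteq> 0\<close> by (simp add: degree_pcompose)
    have "Polynomial.degree p > 0"
    proof (rule ccontr)
      assume "\<not> ?thesis"
      then obtain c where "p = [:c:]" by (auto elim: degree_eq_zeroE)
      with irr show False by (auto simp: Factorial_Ring.irreducible_def is_unit_iff_degree)
    qed
    then obtain g where g: "lead_coeff g = 1" "Polynomial.degree g > 0"
      "2 * Polynomial.degree g \<le> Polynomial.degree p" "g dvd p"
      using nirr by (rule reducible_poly_monic_divisor)
    then obtain h where h: "p = g * h" by blast
    have "g \<noteq> 0" "h \<noteq> 0" using g h \<open>Polynomial.degree p > 0\<close> by auto
    hence "Polynomial.degree h > 0" using g h by (simp add: degree_mult_eq)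
    with g(2) have "\<not> Factorial_Ring.irreducible (pcompose g [:a, b:] * pcompose h [:a, b:])"
      by (intro not_irreducible_mult) (simp_all only: deg)
    with irr h show False by (simp add: pcompose_mult)
  qed
  have inv: "pcompose (pcompose p [:a, b:]) [:- a / b, 1 / b:] = p"
  proof -
    have "pcompose [:a, b:] [:- a / b, 1 / b:] = [:0, 1:]"
      using assms by (simp add: pcompose_pCons)
    thus ?thesis by (simp add: pcompose_assoc [symmetric])
  qed
  show ?thesis
    using *[of p a b] *[of "pcompose p [:a, b:]" "- a / b" "1 / b"] assms unfolding inv by auto
qed

lemma irreducible_smult_iff:
  fixes p :: "'a :: field poly"
  assumes "c \<noteq> 0"
  shows "Factorial_Ring.irreducible (smult c p) \<longleftrightarrow> Factorial_Ring.irreducible p"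
  using irreducible_mult_unit_left[of "[:c:]" p] assms by (simp add: is_unit_iff_degree)

text \<open>
  A root of the quartic makes the discriminant \<open>B\<^sup>2 - 4 C\<close> of the quadratic in \<open>z\<^sup>2\<close> a square, since
  that quadratic then has a root. In a factorization \<open>(z\<^sup>2 + p z + q) (z\<^sup>2 - p z + q')\<close>, either
  \<open>p = 0\<close>, and \<open>(q - q')\<^sup>2\<close> is the discriminant, or \<open>p \<noteq> 0\<close>, and comparing the coefficients of \<open>z\<close>
  gives \<open>q = q'\<close>.
\<close>
lemma irreducible_biquadratic:
  fixes B C :: "'a :: field"
  assumes disc: "\<And>r. r\<^sup>2 \<noteq> B\<^sup>2 - 4 * C"
    and split: "\<And>p q. q\<^sup>2 = C \<Longrightarrow> p\<^sup>2 \<noteq> 2 * q - B"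
  shows "Factorial_Ring.irreducible [:C, 0, B, 0, 1:]" (is "Factorial_Ring.irreducible ?f")
proof (rule ccontr)
  assume "\<not> Factorial_Ring.irreducible ?f"
  moreover have "Polynomial.degree ?f > 0" by simp
  ultimately obtain g where g: "lead_coeff g = 1" "Polynomial.degree g > 0"
    "2 * Polynomial.degree g \<le> Polynomial.degree ?f" "g dvd ?f"
    by (metis reducible_poly_monic_divisor)
  from g(4) obtain h where h: "?f = g * h" by blast
  have nz: "g \<noteq> 0" "h \<noteq> 0" using h by auto
  have deg: "Polynomial.degree g + Polynomial.degree h = 4"
    using arg_cong[OF h, of Polynomial.degree] nz by (simp add: degree_mult_eq)
  have no_root: "poly ?f x \<noteq> 0" for x
  proof
    assume "poly ?f x = 0"
    moreover have "(2 * x\<^sup>2 + B)\<^sup>2 = B\<^sup>2 - 4 * C + 4 * poly ?f x"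
      by (simp add: power2_eq_square algebra_simps)
    ultimately have "(2 * x\<^sup>2 + B)\<^sup>2 = B\<^sup>2 - 4 * C" by simp
    with disc show False by blast
  qed
  have lc: "lead_coeff h = 1"
    using arg_cong[OF h, of lead_coeff] g(1) by (simp add: lead_coeff_mult)
  consider "Polynomial.degree g = 1" | "Polynomial.degree g = 2" using g by force
  thus False
  proof cases
    case 1
    with g(1) have "g = [:coeff g 0, 1:]" by (rule monic_degree_1)
    hence "poly ?f (- coeff g 0) = 0" using g(4) by (metis minus_minus poly_eq_0_iff_dvd)
    with no_root show False by blast
  next
    case 2
    define p q where "p = coeff g 1" and "q = coeff g 0"
    define p' q' where "p' = coeff h 1" and "q' = coeff h 0"
    have g_eq: "g = [:q, p, 1:]"
      unfolding p_def q_def by (rule monic_degree_2) (use g(1) 2 in auto)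
    have h_eq: "h = [:q', p', 1:]"
      unfolding p'_def q'_def by (rule monic_degree_2) (use lc 2 deg in auto)
    have eqs: "C = q * q'" "p * q' + q * p' = 0" "B = q + q' + p * p'" "p + p' = 0"
      using h unfolding g_eq h_eq by (auto simp: algebra_simps)
    show False
    proof (cases "p = 0")
      case True
      hence "(q - q')\<^sup>2 = B\<^sup>2 - 4 * C" using eqs by (simp add: power2_eq_square algebra_simps)
      with disc show False by blast
    next
      case False
      have p': "p' = - p" using eqs(4) by (simp add: add_eq_0_iff)
      have "p * (q' - q) = 0" using eqs(2) p' by (simp add: algebra_simps)
      with False have "q' = q" by simp
      hence "q\<^sup>2 = C" "p\<^sup>2 = 2 * q - B" using eqs p' by (auto simp: power2_eq_square)
      with split show False by blast
    qed
  qed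
qed

section \<open>Iterates, translations and conjugation\<close>

lemma iterate_Suc [simp]: "iterate f 0 = [:0, 1:]" "iterate f (Suc n) = pcompose f (iterate f n)"
  by (simp_all add: iterate_def)

text \<open>
  Conjugation by a translation moves \<open>0\<close> and need not preserve irreducibility of the iterates.
  Substituting \<open>z = x - r\<close> in the iterates themselves does preserve it, and each further application
  of \<open>f\<close> to a polynomial \<open>p\<close> in \<open>z\<close> then yields \<open>h(p - r)\<close>.
\<close>
lemma iterate_translate:
  fixes h :: "'a :: field poly" and r :: 'a
  shows "iterate (pcompose h [:- r, 1:]) (Suc n) =
         pcompose (((\<lambda>p. pcompose h (p - [:r:])) ^^ n) h) [:- r, 1:]"
proof (induction n)
  case 0
  show ?case by (simp add: pcompose_pCons)
next
  case (Suc n)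
  have "pcompose [:- r, 1:] p = p - [:r:]" for p
    by (simp add: pcompose_pCons)
  thus ?case using Suc
    by (simp add: pcompose_assoc [symmetric] pcompose_diff pcompose_const)
qed

lemma newly_reducible_translate:
  fixes h :: "'a :: field poly" and r :: 'a
  defines "F \<equiv> (\<lambda>p. pcompose h (p - [:r:]))"
  assumes "Factorial_Ring.irreducible ((F ^^ n) h)"
    and "\<not> Factorial_Ring.irreducible ((F ^^ Suc n) h)"
  shows "newly_reducible (pcompose h [:- r, 1:]) (Suc (Suc n))"
  using assms by (simp add: newly_reducible_def iterate_translate irreducible_pcompose_linear
    del: iterate_Suc funpow.simps)

text \<open>The conjugate of \<open>f\<close> by the linear map \<open>x \<mapsto> c x\<close>.\<close>
definition rescale :: "'a :: field \<Rightarrow> 'a poly \<Rightarrow> 'a poly" where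
  "rescale c f = smult c (pcompose f [:0, inverse c:])"

lemma iterate_rescale:
  assumes "c \<noteq> 0"
  shows "iterate (rescale c f) n = rescale c (iterate f n)"
proof (induction n)
  case 0
  thus ?case using assms by (simp add: rescale_def pcompose_pCons)
next
  case (Suc n)
  have "pcompose [:0, inverse c:] (smult c p) = p" for p
    using assms by (simp add: pcompose_pCons)
  thus ?case using Suc
    by (simp add: rescale_def pcompose_assoc [symmetric] pcompose_smult)
qed

text \<open>
  All conjugates of \<open>f\<close> by \<open>x \<mapsto> c x\<close> are again newly reducible. Two of them, for \<open>c\<close> and \<open>e\<close>, can
  only agree if their leading coefficients do, that is, if \<open>c ^ (d - 1) = e ^ (d - 1)\<close>; for fixed
  \<open>e\<close> this polynomial equation has finitely many solutions \<open>c\<close>.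
\<close>
lemma in_N_infiniteI:
  fixes f :: "'a :: field poly"
  assumes inf: "infinite (UNIV :: 'a set)"
    and d: "Polynomial.degree f = d" "d \<ge> 2" and f: "newly_reducible f n"
  shows "in_N_infinite d n TYPE('a)"
  unfolding in_N_infinite_def
proof
  let ?S = "{f :: 'a poly. Polynomial.degree f = d \<and> newly_reducible f n}"
  assume fin: "finite ?S"
  have mem: "rescale c f \<in> ?S" if "c \<noteq> 0" for c
    using that d f by (simp add: newly_reducible_def iterate_rescale)
      (simp add: rescale_def irreducible_smult_iff irreducible_pcompose_linear degree_pcompose)
  have "infinite (UNIV - {0 :: 'a})" using inf by simp
  moreover have "finite ((\<lambda>c. rescale c f) ` (UNIV - {0}))"
    by (rule finite_subset[OF _ fin]) (use mem in auto)
  ultimately obtain e where e: "e \<noteq> 0" "infinite {c \<in> UNIV - {0}. rescale c f = rescale e f}"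
    using pigeonhole_infinite[of "UNIV - {0 :: 'a}" "\<lambda>c. rescale c f"] by auto
  define l where "l = lead_coeff f"
  have l: "l \<noteq> 0" using d by (auto simp: l_def)
  have lc: "lead_coeff (rescale c f) = c * (l * inverse c ^ d)" if "c \<noteq> 0" for c
    using that d by (simp add: rescale_def l_def lead_coeff_comp)
  define P where "P = monom (1 :: 'a) (d - 1) - [:e ^ (d - 1):]"
  have "P \<noteq> 0"
  proof
    assume "P = 0"
    hence "coeff P (d - 1) = 0" by simp
    thus False using d by (auto simp: P_def coeff_pCons split: nat.splits)
  qed
  hence "finite {x. poly P x = 0}" by (rule poly_roots_finite)
  moreover have "{c \<in> UNIV - {0}. rescale c f = rescale e f} \<subseteq> {x. poly P x = 0}"
  proof
    fix c assume "c \<in> {c \<in> UNIV - {0}. rescale c f = rescale e f}"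
    hence c: "c \<noteq> 0" "rescale c f = rescale e f" by auto
    hence "c * (l * inverse c ^ d) = e * (l * inverse e ^ d)" using lc e by metis
    hence "c ^ d * e = e ^ d * c"
      using l c(1) e(1) by (simp add: field_simps)
    moreover obtain k where k: "d = Suc k" using d by (cases d) auto
    ultimately have "c ^ k = e ^ k" using c(1) e(1) by (simp add: ac_simps)
    thus "c \<in> {x. poly P x = 0}" using k by (simp add: P_def poly_monom)
  qed
  ultimately show False using e(2) finite_subset by blast
qed


section \<open>Quadratic polynomials and their second iterates\<close>

lemma prime_neq_CHAR_imp_nonzero:
  assumes "prime p" "CHAR('a :: field) \<noteq> p"
  shows "of_nat p \<noteq> (0 :: 'a)"
  using assms CHAR_not_1[where ?'a = 'a]
  by (auto simp: of_nat_eq_0_iff_char_dvd prime_nat_iff)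

lemma four_neq_0: "(2 :: 'a :: field) \<noteq> 0 \<Longrightarrow> (4 :: 'a) \<noteq> 0"
  by (metis mult_2 mult_eq_0_iff numeral_Bit0)

lemma nth_powers_iff: "x \<in> nth_powers n \<longleftrightarrow> (\<exists>k. x = k ^ n)"
  by (auto simp: nth_powers_def)

lemma nonsquare_times_square:
  fixes d :: "'a :: field"
  assumes "\<And>r. r\<^sup>2 \<noteq> d" "t \<noteq> 0"
  shows "d * t\<^sup>2 \<noteq> r\<^sup>2"
proof
  assume "d * t\<^sup>2 = r\<^sup>2"
  hence "(r / t)\<^sup>2 = d" using assms(2) by (simp add: field_simps)
  with assms(1) show False by blast
qed

text \<open>
  For a nonsquare \<open>e\<close>, the conic \<open>a\<^sup>2 - e s\<^sup>2 = 1\<close> has the point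
  \<open>a = (1 + e) / (1 - e)\<close>, \<open>s = 2 / (1 - e)\<close>, and \<open>a\<^sup>2 - 1 = e s\<^sup>2\<close> is not a square. The element
  \<open>a\<close> is nonzero unless \<open>e = -1\<close>, which is avoided by multiplying \<open>e\<close> by a suitable square.
\<close>
lemma exists_nonsquare_minus_1:
  assumes inf: "infinite (UNIV :: 'a :: field set)" and two: "(2 :: 'a) \<noteq> 0"
    and "(UNIV :: 'a set) \<noteq> nth_powers 2"
  obtains a :: "'a :: field" where "a \<noteq> 0" "\<And>r. r\<^sup>2 \<noteq> a\<^sup>2 - 1"
proof -
  obtain d :: 'a where d: "\<And>r. r\<^sup>2 \<noteq> d"
    using assms(3) by (metis UNIV_eq_I nth_powers_iff)
  have dt: "d * t\<^sup>2 \<noteq> r\<^sup>2" if "t \<noteq> 0" for t r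
    using d that by (rule nonsquare_times_square)
  obtain t where t: "t \<noteq> 0" "d * t\<^sup>2 \<noteq> -1"
  proof -
    have "d \<noteq> 0" using d[of 0] by auto
    hence "[:1, 0, d:] * [:0, 1:] \<noteq> 0" by simp
    hence "finite {t. poly ([:1, 0, d:] * [:0, 1:]) t = 0}" by (rule poly_roots_finite)
    hence "{t. poly ([:1, 0, d:] * [:0, 1:]) t = 0} \<noteq> UNIV" using inf by metis
    then obtain t where "poly ([:1, 0, d:] * [:0, 1:]) t \<noteq> 0" by blast
    hence "t \<noteq> 0" "d * t\<^sup>2 \<noteq> -1"
      by (auto simp: power2_eq_square ac_simps)
    thus thesis by (rule that)
  qed
  define e where "e = d * t\<^sup>2"
  have e: "e \<noteq> -1" "\<And>r. r\<^sup>2 \<noteq> e" using t(2) dt[OF t(1)] unfolding e_def by metis+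
  from e(2)[of 1] have "e \<noteq> 1" by auto
  have "1 - e \<noteq> 0" "1 + e \<noteq> 0" using e(1) \<open>e \<noteq> 1\<close> by (auto simp: add_eq_0_iff)
  show thesis
  proof (rule that[of "(1 + e) / (1 - e)"])
    show "(1 + e) / (1 - e) \<noteq> 0" using \<open>1 - e \<noteq> 0\<close> \<open>1 + e \<noteq> 0\<close> by simp
    fix r show "r\<^sup>2 \<noteq> ((1 + e) / (1 - e))\<^sup>2 - 1"
    proof
      assume "r\<^sup>2 = ((1 + e) / (1 - e))\<^sup>2 - 1"
      hence "r\<^sup>2 * (1 - e)\<^sup>2 = (1 + e)\<^sup>2 - (1 - e)\<^sup>2"
        using \<open>1 - e \<noteq> 0\<close> by (simp add: power_divide left_diff_distrib)
      hence "(r * (1 - e))\<^sup>2 = (1 + e)\<^sup>2 - (1 - e)\<^sup>2"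
        by (simp add: power_mult_distrib)
      also have "\<dots> = 2\<^sup>2 * e" by (simp add: power2_eq_square algebra_simps)
      finally have "(r * (1 - e) / 2)\<^sup>2 = e" using two four_neq_0[OF two] by (simp add: power_divide)
      with e(2) show False by blast
    qed
  qed
qed

text \<open>
  The second iterate of \<open>x\<^sup>2 + c\<close> equals \<open>(x\<^sup>2 + a x + b) (x\<^sup>2 - a x + b)\<close> if and only if
  \<open>2 b - a\<^sup>2 = 2 c\<close> and \<open>b\<^sup>2 = c\<^sup>2 + c\<close>. Eliminating \<open>b\<close> gives \<open>4 c (1 - a\<^sup>2) = a ^ 4\<close>. Hence \<open>-c\<close>
  is \<open>a\<^sup>2 - 1\<close> up to a square factor.
\<close>
lemma newly_reducible_2_2:
  assumes inf: "infinite (UNIV :: 'a :: field set)" and two: "(2 :: 'a) \<noteq> 0"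
    and ns: "(UNIV :: 'a set) \<noteq> nth_powers 2"
  obtains f :: "'a :: field poly" where "Polynomial.degree f = 2" "newly_reducible f 2"
proof -
  obtain a :: 'a where a: "a \<noteq> 0" "\<And>r. r\<^sup>2 \<noteq> a\<^sup>2 - 1"
    using exists_nonsquare_minus_1[OF assms] by metis
  have nz: "1 - a\<^sup>2 \<noteq> 0" using a(2)[of 0] by auto
  define c where "c = a ^ 4 / (4 * (1 - a\<^sup>2))"
  define b where "b = c + a\<^sup>2 / 2"
  have four: "(4 :: 'a) \<noteq> 0" using two by (rule four_neq_0)
  have "4 * (1 - a\<^sup>2) \<noteq> 0" using nz four by (simp only: mult_eq_0_iff) simp
  hence "c * (4 * (1 - a\<^sup>2)) = a ^ 4" 
    unfolding c_def by (metis nonzero_eq_divide_eq)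
  hence c: "4 * c * (1 - a\<^sup>2) = a ^ 4" by (simp only: mult_ac)
  have b: "2 * b = 2 * c + a\<^sup>2" using two by (simp add: b_def distrib_left)
  have "4 * b\<^sup>2 = (2 * b)\<^sup>2" by (simp add: power2_eq_square)
  also have "\<dots> = 4 * (c\<^sup>2 + c) + (a ^ 4 - 4 * c * (1 - a\<^sup>2))"
    unfolding b by (simp add: power2_eq_square power4_eq_xxxx algebra_simps)
  finally have "4 * b\<^sup>2 = 4 * (c\<^sup>2 + c)" using c by simp
  hence b2: "b\<^sup>2 = c\<^sup>2 + c" using four by (simp only: mult_cancel_left) simp
  have "Factorial_Ring.irreducible [:c, 0, 1:]"
  proof (rule irreducible_if_no_root)
    fix x show "poly [:c, 0, 1:] x \<noteq> 0"
    proof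
      assume "poly [:c, 0, 1:] x = 0"
      hence x: "x\<^sup>2 = - c" by (simp add: power2_eq_square eq_neg_iff_add_eq_0 add.commute)
      have "(2 * x * (1 - a\<^sup>2) / a\<^sup>2)\<^sup>2 = 4 * x\<^sup>2 * (1 - a\<^sup>2)\<^sup>2 / a ^ 4"
        by (simp add: power_divide power_mult_distrib flip: power_mult)
      also have "4 * x\<^sup>2 * (1 - a\<^sup>2)\<^sup>2 = - (4 * c * (1 - a\<^sup>2)) * (1 - a\<^sup>2)"
        unfolding x by (simp add: power2_eq_square)
      also have "\<dots> / a ^ 4 = a\<^sup>2 - 1" unfolding c using a(1) by simp
      finally show False using a(2) by blast
    qed
  qed simp_all
  moreover have "iterate [:c, 0, 1:] 2 = [:b, a, 1:] * [:b, -a, 1:]"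
    using b b2 by (simp add: numeral_2_eq_2 pcompose_pCons power2_eq_square algebra_simps mult_2)
  hence "\<not> Factorial_Ring.irreducible (iterate [:c, 0, 1:] 2)"
    by (simp only:) (rule not_irreducible_mult, simp_all)
  ultimately have "newly_reducible [:c, 0, 1:] 2"
    by (simp add: newly_reducible_def pcompose_pCons)
  thus thesis by (intro that) auto
qed

text \<open>If every element is a square, the quadratic formula provides a root.\<close>
lemma irreducible_quadratic_imp_nonsquare:
  fixes f :: "'a :: field poly"
  assumes two: "(2 :: 'a) \<noteq> 0" and f: "Polynomial.degree f = 2" "Factorial_Ring.irreducible f"
  shows "(UNIV :: 'a set) \<noteq> nth_powers 2"
proof
  assume "(UNIV :: 'a set) = nth_powers 2"
  hence sq: "\<exists>r. r\<^sup>2 = x" for x :: 'a by (metis UNIV_I nth_powers_iff)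
  define a b c where "a = coeff f 2" and "b = coeff f 1" and "c = coeff f 0"
  have f_eq: "f = [:c, b, a:]"
    unfolding a_def b_def c_def using f(1)
    by (intro poly_eqI) (auto simp: coeff_pCons coeff_eq_0 numeral_2_eq_2 split: nat.splits)
  have a: "a \<noteq> 0" using f(1) unfolding a_def by (metis degree_0 leading_coeff_0_iff zero_neq_numeral)
  obtain r where r: "r\<^sup>2 = b\<^sup>2 - 4 * a * c" using sq by blast
  define x where "x = (r - b) / (2 * a)"
  have "2 * a * x = r - b" using two a by (simp add: x_def)
  hence "4 * a * poly f x = (2 * a * x)\<^sup>2 + 2 * b * (2 * a * x) + 4 * a * c" 
    by (simp add: f_eq power2_eq_square algebra_simps)
  also have "\<dots> = 0" unfolding \<open>2 * a * x = r - b\<close> using r by (simp add: power2_eq_square algebra_simps)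
  finally have "poly f x = 0" using a two by (metis mult_2 mult_eq_0_iff numeral_Bit0)
  then obtain g where g: "f = [:-x, 1:] * g" by (auto simp: poly_eq_0_iff_dvd)
  hence "g \<noteq> 0" using a f_eq by auto
  with g f(1) have "Polynomial.degree g = 1" by (simp add: degree_mult_eq del: mult_pCons_left)
  hence "\<not> Factorial_Ring.irreducible f" unfolding g by (intro not_irreducible_mult) auto
  with f show False by blast
qed

text \<open>
  All \<open>d t\<^sup>2\<close> with \<open>d\<close> a fixed nonsquare and \<open>t \<noteq> 0\<close> are nonsquares, and each of them comes from at
  most two values of \<open>t\<close>.
\<close>
lemma infinite_nonsquares:
  assumes inf: "infinite (UNIV :: 'a :: field set)" and ns: "(UNIV :: 'a set) \<noteq> nth_powers 2"
  shows "infinite (UNIV - nth_powers 2 :: 'a set)"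
proof
  assume fin: "finite (UNIV - nth_powers 2 :: 'a set)"
  obtain d :: 'a where d: "\<And>r. r\<^sup>2 \<noteq> d"
    using ns by (metis UNIV_eq_I nth_powers_iff)
  have dt: "d * t\<^sup>2 \<noteq> r\<^sup>2" if "t \<noteq> 0" for t r
    using d that by (rule nonsquare_times_square)
  have d0: "d \<noteq> 0" using d[of 0] by auto
  have "infinite (UNIV - {0 :: 'a})" using inf by simp
  moreover have "finite ((\<lambda>t. d * t\<^sup>2) ` (UNIV - {0}))"
    by (rule finite_subset[OF _ fin]) (use dt in \<open>auto simp: nth_powers_iff\<close>)
  ultimately obtain s where s: "infinite {t \<in> UNIV - {0}. d * t\<^sup>2 = d * s\<^sup>2}"
    using pigeonhole_infinite[of "UNIV - {0 :: 'a}" "\<lambda>t. d * t\<^sup>2"] by auto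
  moreover have "{t \<in> UNIV - {0}. d * t\<^sup>2 = d * s\<^sup>2} \<subseteq> {s, -s}"
    using d0 by (auto simp: power2_eq_iff)
  ultimately show False by (meson finite.emptyI finite_insert finite_subset)
qed

section \<open>Discrete valuations\<close>

lemma valuation_mult:
  assumes "discrete_valuation v" "x \<noteq> 0" "y \<noteq> 0"
  shows "v (x * y) = v x + v y"
  using assms by (simp add: discrete_valuation_def)

lemma valuation_1:
  assumes "discrete_valuation v"
  shows "v 1 = 0"
  using valuation_mult[OF assms, of 1 1] by simp

lemma valuation_power:
  assumes "discrete_valuation v" "x \<noteq> 0"
  shows "v (x ^ n) = int n * v x"
  using assms by (induction n) (simp_all add: valuation_1 valuation_mult algebra_simps)

lemma valuation_minus:
  assumes "discrete_valuation v" "x \<noteq> 0"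
  shows "v (- x) = v x"
proof -
  have "2 * v (-1) = v ((-1)\<^sup>2)" using assms by (subst valuation_power) auto
  also have "\<dots> = 0" using valuation_1[OF assms(1)] by simp
  finally have "v (-1) = 0" by simp
  thus ?thesis using valuation_mult[OF assms(1), of "-1" x] assms(2) by simp
qed

lemma valuation_powi:
  assumes "discrete_valuation v" "x \<noteq> 0"
  shows "v (x powi k) = k * v x"
proof -
  have inv: "v (inverse y) = - v y" if "y \<noteq> 0" for y
    using valuation_mult[OF assms(1), of y "inverse y"] that valuation_1[OF assms(1)] by simp
  show ?thesis
    using assms by (cases "k \<ge> 0") (simp_all add: power_int_def valuation_power inv)
qed

text \<open>
  The valuation is not assumed to be surjective. Its values form a nonzero subgroup of the
  integers; an element whose value is the least positive one serves as a uniformizer.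
\<close>
lemma valuation_image_multiples:
  assumes v: "discrete_valuation v" and nontriv: "nontrivial_valuation v"
  obtains p where "p \<noteq> 0" "v p > 0" "\<And>x. x \<noteq> 0 \<Longrightarrow> v p dvd v x"
proof -
  define S where "S = {n. n > 0 \<and> (\<exists>x. x \<noteq> 0 \<and> v x = int n)}"
  obtain x where x: "x \<noteq> 0" "v x \<noteq> 0" using nontriv by (auto simp: nontrivial_valuation_def)
  have "v (x powi sgn (v x)) = \<bar>v x\<bar>"
    using x by (subst valuation_powi[OF v]) (auto simp: abs_sgn mult.commute)
  hence "nat \<bar>v x\<bar> \<in> S" using x unfolding S_def by (auto intro!: exI[of _ "x powi sgn (v x)"])
  hence "(LEAST n. n \<in> S) \<in> S" by (rule LeastI)
  then obtain p where p: "p \<noteq> 0" "v p = int (LEAST n. n \<in> S)" "v p > 0" by (auto simp: S_def)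
  show thesis
  proof (rule that[OF p(1) p(3)])
    fix y :: 'a assume y: "y \<noteq> 0"
    define z where "z = y * p powi (- (v y div v p))"
    have z: "z \<noteq> 0" using y p by (simp add: z_def)
    have "v z = v y mod v p"
      using y p by (simp add: z_def valuation_mult[OF v] valuation_powi[OF v] minus_div_mult_eq_mod)
    hence "nat (v z) \<notin> S \<or> v p \<le> v z"
      using p by (metis Least_le int_nat_eq of_nat_mono pos_mod_sign)
    moreover have "v z < v p" "v z \<ge> 0" using \<open>v z = _\<close> p by auto
    ultimately have "nat (v z) \<notin> S" by simp
    hence "v z = 0" using z \<open>v z \<ge> 0\<close> unfolding S_def by auto
    thus "v p dvd v y" using \<open>v z = v y mod v p\<close> by auto
  qed
qed

section \<open>A quadratic polynomial with newly reducible third iterate\<close>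

text \<open>
  With \<open>h = z\<^sup>2 + 4\<close> and \<open>r = 5\<close>, the second iterate is \<open>(z\<^sup>2 - 1)\<^sup>2 + 4 = z ^ 4 - 2 z\<^sup>2 + 5\<close>. Its
  discriminant as a quadratic in \<open>z\<^sup>2\<close> is \<open>-16\<close> and its constant term is \<open>5\<close>, so that the criterion
  for biquadratic polynomials asks for \<open>-1\<close> and \<open>5\<close> to be nonsquares. The third iterate is
  \<open>(z ^ 4 - 2 z\<^sup>2)\<^sup>2 + 4 = (z ^ 4 + 2)\<^sup>2 - (2 z ^ 3)\<^sup>2\<close>.

  To find this polynomial, let \<open>\<sigma>\<^sup>2 = - 4\<close> and \<open>\<tau>\<^sup>2 = \<sigma> + 1\<close>, so that \<open>\<tau>\<close> is a root of the second
  iterate. The roots of the third iterate are the square roots of \<open>\<tau> + 1\<close>, and \<open>\<tau> + 1\<close> is the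
  square of \<open>p + \<tau> / (2 p)\<close> with \<open>p = (2 + \<sigma>) / 4\<close>.
\<close>
lemma newly_reducible_2_3:
  assumes two: "(2 :: 'a :: field) \<noteq> 0"
    and ns: "\<And>r :: 'a. r\<^sup>2 \<noteq> -1" "\<And>r :: 'a. r\<^sup>2 \<noteq> 5"
  shows "newly_reducible (pcompose [:4, 0, 1:] [:- 5, 1:] :: 'a poly) 3"
proof -
  let ?h = "[:4, 0, 1:] :: 'a poly"
  have four: "(4 :: 'a) \<noteq> 0" using two by (rule four_neq_0)
  have F1: "pcompose ?h (?h - [:5:]) = [:5, 0, -2, 0, 1:]"
    by (simp add: pcompose_pCons)
  have F2: "pcompose ?h ([:5, 0, -2, 0, 1:] - [:5:]) = [:2, 0, 0, -2, 1:] * [:2, 0, 0, 2, 1:]"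
    by (simp add: pcompose_pCons)
  have "Factorial_Ring.irreducible [:5, 0, -2 :: 'a, 0, 1:]"
  proof (rule irreducible_biquadratic)
    fix r :: 'a
    have "(-2)\<^sup>2 - 4 * 5 = (-1) * (4 :: 'a)\<^sup>2" by simp
    moreover have "r\<^sup>2 \<noteq> (-1) * 4\<^sup>2"
    proof
      assume "r\<^sup>2 = (-1) * 4\<^sup>2"
      hence "(r / 4)\<^sup>2 = (-1) * 4\<^sup>2 / 4\<^sup>2" by (simp only: power_divide)
      also have "\<dots> = -1" using four by (intro nonzero_mult_div_cancel_right) (rule power_not_zero)
      finally have "(r / 4)\<^sup>2 = -1" .
      with ns show False by blast
    qed
    ultimately show "r\<^sup>2 \<noteq> (-2)\<^sup>2 - 4 * 5" by simp
  qed (use ns in blast)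
  moreover have "\<not> Factorial_Ring.irreducible ([:2, 0, 0, -2, 1:] * [:2, 0, 0, 2 :: 'a, 1:])"
    by (rule not_irreducible_mult) auto
  ultimately show ?thesis
    using newly_reducible_translate[where r = 5 and h = ?h and n = 1] by (simp only: F1 F2 funpow.simps One_nat_def o_apply id_apply numeral_3_eq_3
      simp_thms True_implies_equals)
qed


lemma odd_valuation_imp_nonsquare:
  assumes "discrete_valuation v" "x \<noteq> 0" "odd (v x)"
  shows "r\<^sup>2 \<noteq> x"
proof
  assume r: "r\<^sup>2 = x"
  hence "r \<noteq> 0" using assms by auto
  hence "v x = 2 * v r" using r valuation_power[OF assms(1), of r 2] by auto
  with assms(3) show False by simp
qed

text \<open>
  If the residue field has three elements, every algebraic integer is congruent modulo \<open>P\<close> to an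
  integer. A square root of \<open>n\<close> would be an algebraic integer, hence \<open>n\<close> would be a square
  modulo \<open>3\<close>.

  That the residue degree is \<open>1\<close> says that the residue field is spanned by some class \<open>w\<close> over the
  image of the integers. The proof multiplies with an integer \<open>k\<close> that inverts \<open>w\<close> modulo \<open>P\<close>
  in place of identifying the residue field with the image of the integers.
\<close>
lemma prime_over_3_imp_nonsquare:
  fixes P :: "'a :: field set" and n :: int and r :: 'a
  assumes P: "primeideal P ring_of_integers" "lies_over P 3" "residue_degree P 1"
    and n: "n mod 3 = 2"
  shows "r\<^sup>2 \<noteq> of_int n"
proof
  assume r: "r\<^sup>2 = of_int n"
  let ?O = "ring_of_integers :: 'a ring"
  interpret primeideal P ?O by fact
  have carrier: "x \<in> carrier ?O \<longleftrightarrow> algebraic_int x" for x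
    by (simp add: ring_of_integers_def)
  have ops: "x \<otimes>\<^bsub>?O\<^esub> y = x * y" "x \<oplus>\<^bsub>?O\<^esub> y = x + y" "\<one>\<^bsub>?O\<^esub> = 1" for x y :: 'a
    by (simp_all add: ring_of_integers_def ring_of_type_algebra_def)
  have int_alg: "algebraic_int (of_int k :: 'a)" for k
    by (rule int_imp_algebraic_int) simp
  have int_P: "of_int k \<in> P \<longleftrightarrow> 3 dvd k" for k
    using P(2) by (simp add: lies_over_def)
  have r_alg: "algebraic_int r"
    by (rule algebraic_int.intros[of "[:- of_int n, 0, 1:]"])
      (use r in \<open>auto simp: coeff_pCons power2_eq_square split: nat.splits\<close>)
  have mult_P: "x * y \<in> P" if "x \<in> P" "algebraic_int y" for x y
    using I_r_closed[OF that(1), of y] that(2) by (simp add: carrier ops)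
  have add_P: "x + y \<in> P" if "x \<in> P" "y \<in> P" for x y
    using additive_subgroup.a_closed[OF is_additive_subgroup that] by (simp add: ops)
  have uminus_P: "- x \<in> P" if "x \<in> P" for x
    using mult_P[OF that int_alg[of "-1"]] by simp
  have diff_P: "x - y \<in> P" if "x \<in> P" "y \<in> P" for x y
    using add_P[OF that(1) uminus_P[OF that(2)]] by simp

  let ?F = "?O Quot P"
  interpret F: ring ?F by (rule quotient_is_ring)
  have "F.dimension 1 (range (\<lambda>m :: int. P +>\<^bsub>?O\<^esub> of_int m)) (carrier ?F)"
    using P(3) by (simp add: residue_degree_def Let_def)
  then obtain u where u: "u \<in> carrier ?F"
    "carrier ?F = F.line_extension (range (\<lambda>m :: int. P +>\<^bsub>?O\<^esub> of_int m)) u {\<zero>\<^bsub>?F\<^esub>}"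
    by (auto elim!: F.dimension.cases)
  have carrier_F: "carrier ?F = {P +>\<^bsub>?O\<^esub> x |x. algebraic_int x}"
    by (auto simp: FactRing_def A_RCOSETS_def' carrier)
  obtain w where w: "algebraic_int w" "u = P +>\<^bsub>?O\<^esub> w"
    using u(1) by (auto simp: carrier_F)
  have rep: "\<exists>m :: int. x - of_int m * w \<in> P" if "algebraic_int x" for x
  proof -
    have "P +>\<^bsub>?O\<^esub> x \<in> carrier ?F" using that by (auto simp: carrier_F)
    then obtain m :: int where m: "P +>\<^bsub>?O\<^esub> x = (P +>\<^bsub>?O\<^esub> of_int m) \<otimes>\<^bsub>?F\<^esub> u \<oplus>\<^bsub>?F\<^esub> \<zero>\<^bsub>?F\<^esub>"
      unfolding u(2) F.line_extension_mem_iff by auto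
    have "P +>\<^bsub>?O\<^esub> of_int m \<in> carrier ?F" by (auto simp: carrier_F int_alg)
    hence "P +>\<^bsub>?O\<^esub> x = (P +>\<^bsub>?O\<^esub> of_int m) \<otimes>\<^bsub>?F\<^esub> u" using m u(1) by simp
    also have "\<dots> = P +>\<^bsub>?O\<^esub> (of_int m * w)"
      unfolding w(2) using rcoset_mult_add[of "of_int m" w] w(1) int_alg
      by (simp add: FactRing_def carrier ops)
    finally have eq: "P +>\<^bsub>?O\<^esub> x = P +>\<^bsub>?O\<^esub> (of_int m * w)" .
    have "x \<in> P +>\<^bsub>?O\<^esub> x" using that a_rcos_self by (simp add: carrier)
    then obtain y where "y \<in> P" "x = y + of_int m * w"
      unfolding eq by (auto simp: a_r_coset_def r_coset_def ops)
    thus ?thesis by (intro exI[of _ m]) simp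
  qed
  obtain k where k: "1 - of_int k * w \<in> P" using rep[of 1] by auto
  obtain m where m: "r - of_int m * w \<in> P" using rep[OF r_alg] by auto
  have k3: "\<not> 3 dvd k"
  proof
    assume "3 dvd k"
    hence "of_int k * w \<in> P" using mult_P[of "of_int k" w] w(1) by (simp add: int_P)
    with k have "1 - of_int k * w + of_int k * w \<in> P" by (rule add_P)
    hence "of_int 1 \<in> P" by simp
    thus False unfolding int_P by simp
  qed
  \<comment> \<open>\<open>k\<close> inverts \<open>w\<close> modulo \<open>P\<close>, so \<open>k r\<close> is congruent to the integer \<open>m\<close>.\<close>
  have "of_int k * (r - of_int m * w) - of_int m * (1 - of_int k * w) \<in> P"
    using mult_P[OF m int_alg[of k]] mult_P[OF k int_alg[of m]]
    by (intro diff_P) (simp_all add: mult.commute)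
  hence 1: "of_int k * r - of_int m \<in> P" by (simp add: algebra_simps)
  have "of_int m \<in> carrier ?O" "of_int k \<in> carrier ?O" "r \<in> carrier ?O" by (simp_all add: carrier int_alg r_alg)
  hence "of_int k * r + of_int m \<in> carrier ?O"
    using a_closed m_closed by (metis ops(1,2))
  hence "algebraic_int (of_int k * r + of_int m)" by (simp only: carrier)
  with 1 have "(of_int k * r - of_int m) * (of_int k * r + of_int m) \<in> P"
    by (rule mult_P)
  also have "(of_int k * r - of_int m) * (of_int k * r + of_int m) = of_int (k\<^sup>2 * n - m\<^sup>2)"
    using r by (simp add: power2_eq_square algebra_simps)
  finally have "3 dvd k\<^sup>2 * n - m\<^sup>2" unfolding int_P .
  hence "(k\<^sup>2 * n) mod 3 = m\<^sup>2 mod 3" by (simp add: mod_eq_dvd_iff)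
  hence "((k mod 3)\<^sup>2 * 2) mod 3 = (m mod 3)\<^sup>2 mod 3"
    using n by (metis mod_mult_eq mod_mod_trivial power_mod)
  moreover have "k mod 3 = 1 \<or> k mod 3 = 2" using k3 by presburger
  moreover have "m mod 3 = 0 \<or> m mod 3 = 1 \<or> m mod 3 = 2" by presburger
  ultimately show False by auto
qed

section \<open>A cubic and a quartic polynomial\<close>

text \<open>
  Let \<open>\<theta> ^ 3 = 2\<close>. The identity \<open>9 (\<theta> - 1) = (1 - \<theta> + \<theta>\<^sup>2) ^ 3\<close> is the reason for
  \<open>h = (z ^ 3 - 2) / 9\<close>: the constant \<open>r = - 11 / 9\<close> makes \<open>h - r = (z ^ 3 + 9) / 9\<close>, so that
  the roots of \<open>h(h - r)\<close> are the cube roots of \<open>9 (\<theta> - 1)\<close> for the three choices of \<open>\<theta>\<close>. One of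
  these roots is \<open>1 - \<theta> + \<theta>\<^sup>2 = 3 / (1 + \<theta>)\<close>, of degree 3 over the field, and the cubic factor below
  is its minimal polynomial.
\<close>
lemma newly_reducible_3_2:
  assumes three: "(3 :: 'a :: field) \<noteq> 0" and nc: "\<And>r :: 'a. r ^ 3 \<noteq> 2"
  obtains f :: "'a :: field poly" where "Polynomial.degree f = 3" "newly_reducible f 2"
proof -
  define i :: 'a where "i = 1 / 9"
  let ?p = "[:-2, 0, 0, 1:] :: 'a poly"
  define h where "h = smult i ?p"
  define r where "r = - 11 * i"
  have "(9 :: 'a) = 3 * 3" by simp
  hence nine: "(9 :: 'a) \<noteq> 0" using three by (metis mult_eq_0_iff)
  hence i: "9 * i = 1" "i \<noteq> 0" by (auto simp: i_def)
  have "Factorial_Ring.irreducible ?p"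
    by (rule irreducible_if_no_root) (use nc in \<open>auto simp: power3_eq_cube algebra_simps\<close>)
  hence "Factorial_Ring.irreducible h"
    unfolding h_def using i by (subst irreducible_smult_iff) auto
  moreover have "\<not> Factorial_Ring.irreducible (pcompose h (h - [:r:]))"
  proof -
    let ?G = "[:9, 0, 0, 1:] :: 'a poly"
    have "h - [:r:] = smult i ?G"
      by (simp add: h_def r_def algebra_simps)
    moreover have "pcompose ?p q = q ^ 3 - [:2:]" for q
      by (simp add: pcompose_pCons power3_eq_cube)
    moreover have "[:2:] = smult (i ^ 3) [:1458:]"
    proof -
      have "i ^ 3 * 1458 = 2 * (9 * i) ^ 3" by (simp add: power_mult_distrib)
      thus ?thesis by (simp add: i)
    qed
    ultimately have "pcompose h (h - [:r:]) =
        smult (i) (smult (i ^ 3) (?G ^ 3) - smult (i ^ 3) [:1458:])"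
      by (simp only: h_def pcompose_smult smult_power)
    hence "pcompose h (h - [:r:]) = smult (i ^ 4) (?G ^ 3 - [:1458:])"
      by (simp only: smult_diff_right [symmetric] smult_smult) (simp add: eval_nat_numeral)
    also have "?G ^ 3 - [:1458:] = [:-9, 9, -3, 1:] * [:81, 81, 54, 9, 0, 3, 1:]"
      by (simp add: power3_eq_cube)
    finally show ?thesis
      using not_irreducible_mult[of "[:-9, 9, -3, 1:]" "[:81, 81, 54, 9, 0, 3, 1 :: 'a:]"] i
      by (simp add: irreducible_smult_iff del: mult_pCons_left mult_pCons_right)
  qed
  ultimately have "newly_reducible (pcompose h [:- r, 1:]) 2"
    using newly_reducible_translate[where r = r and h = h and n = 0] by (simp add: numeral_2_eq_2)
  moreover have "Polynomial.degree (pcompose h [:- r, 1:]) = 3"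
    using i by (simp add: degree_pcompose h_def)
  ultimately show thesis using that by blast
qed

text \<open>
  Let \<open>\<theta> ^ 4 = 12\<close>. The identity \<open>16 (7 - 2 \<theta>) = (4 + 2 \<theta> - 2 \<theta>\<^sup>2 + \<theta> ^ 3)\<^sup>2\<close> is the reason for
  \<open>h = - (z ^ 4 - 12) / 2\<close>: the constant \<open>r = 5 / 2\<close> makes \<open>h - r = (7 - z ^ 4) / 2\<close>, so that the
  roots of \<open>h(h - r)\<close> are the fourth roots of the elements \<open>7 - 2 \<theta>\<close>. As \<open>7 - 2 \<theta>\<close> is the square
  of \<open>\<gamma> = (4 + 2 \<theta> - 2 \<theta>\<^sup>2 + \<theta> ^ 3) / 4\<close>, whose minimal polynomial is
  \<open>M(y) = y ^ 4 - 4 y ^ 3 - 6 y\<^sup>2 + 44 y - 47\<close>, the two factors are \<open>M(z\<^sup>2)\<close> and \<open>M(- z\<^sup>2)\<close>.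

  The two hypotheses are those of the criterion for biquadratic polynomials: \<open>12\<close> is a square if
  and only if \<open>3\<close> is, and \<open>q\<^sup>2 = - 12\<close>, \<open>p\<^sup>2 = 2 q\<close> would give \<open>(p / 2) ^ 4 = - 3\<close>.
\<close>
lemma newly_reducible_4_2:
  assumes two: "(2 :: 'a :: field) \<noteq> 0"
    and ns: "\<And>r :: 'a. r ^ 2 \<noteq> 3" "\<And>r :: 'a. r ^ 4 \<noteq> -3"
  obtains f :: "'a :: field poly" where "Polynomial.degree f = 4" "newly_reducible f 2"
proof -
  define i :: 'a where "i = 1 / 2"
  let ?p = "[:-12, 0, 0, 0, 1:] :: 'a poly"
  define h where "h = smult (- i) ?p"
  define r where "r = 5 * i"
  have i: "2 * i = 1" "i \<noteq> 0" using two by (auto simp: i_def)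
  have "Factorial_Ring.irreducible ?p"
  proof (rule irreducible_biquadratic)
    fix s :: 'a
    show "s\<^sup>2 \<noteq> 0\<^sup>2 - 4 * - 12"
    proof
      assume "s\<^sup>2 = 0\<^sup>2 - 4 * - 12"
      hence "(i ^ 2 * s) ^ 2 = 3 * (2 * i) ^ 4"
        by (simp add: power_mult_distrib)
      with ns(1) show False by (simp add: i)
    qed
  next
    fix p q :: 'a assume q: "q\<^sup>2 = - 12"
    show "p\<^sup>2 \<noteq> 2 * q - 0"
    proof
      assume p: "p\<^sup>2 = 2 * q - 0"
      have "(i * p) ^ 4 = i ^ 4 * (p\<^sup>2)\<^sup>2" by (simp add: power_mult_distrib)
      also have "\<dots> = i ^ 4 * 4 * q\<^sup>2" unfolding p by (simp add: power_mult_distrib)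
      also have "\<dots> = -3 * (2 * i) ^ 4" unfolding q by (simp add: power_mult_distrib)
      finally show False using ns(2) by (simp add: i)
    qed
  qed
  hence "Factorial_Ring.irreducible h"
    unfolding h_def using i by (subst irreducible_smult_iff) auto
  moreover have "\<not> Factorial_Ring.irreducible (pcompose h (h - [:r:]))"
  proof -
    let ?G = "[:7, 0, 0, 0, -1:] :: 'a poly"
    have "h - [:r:] = smult i ?G"
      by (simp add: h_def r_def algebra_simps)
    moreover have "pcompose ?p q = q ^ 4 - [:12:]" for q
      by (simp add: pcompose_pCons power4_eq_xxxx)
    moreover have "[:12:] = smult (i ^ 4) [:192:]"
    proof -
      have "i ^ 4 * 192 = 12 * (2 * i) ^ 4" by (simp add: power_mult_distrib)
      thus ?thesis by (simp add: i)
    qed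
    ultimately have "pcompose h (h - [:r:]) =
        smult (- i) (smult (i ^ 4) (?G ^ 4) - smult (i ^ 4) [:192:])"
      by (simp only: h_def pcompose_smult smult_power)
    hence "pcompose h (h - [:r:]) = smult (- (i ^ 5)) (?G ^ 4 - [:192:])"
      by (simp only: smult_diff_right [symmetric] smult_smult) (simp add: eval_nat_numeral)
    also have "?G ^ 4 - [:192:] =
      [:-47, 0, -44, 0, -6, 0, 4, 0, 1:] * [:-47, 0, 44, 0, -6, 0, -4, 0, 1:]"
      by (simp add: power4_eq_xxxx)
    finally show ?thesis
      using not_irreducible_mult[of "[:-47, 0, -44, 0, -6, 0, 4, 0, 1 :: 'a:]"
          "[:-47, 0, 44, 0, -6, 0, -4, 0, 1 :: 'a:]"] i
      by (simp add: irreducible_smult_iff del: mult_pCons_left mult_pCons_right smult_minus_left)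
  qed
  ultimately have "newly_reducible (pcompose h [:- r, 1:]) 2"
    using newly_reducible_translate[where r = r and h = h and n = 0] by (simp add: numeral_2_eq_2)
  moreover have "Polynomial.degree (pcompose h [:- r, 1:]) = 4"
    using i by (simp add: degree_pcompose h_def)
  ultimately show thesis using that by blast
qed

section \<open>Polynomials of degree twice an odd number\<close>

lemma map_poly_to_ac_mult:
  "map_poly to_ac (p * q) = map_poly to_ac p * map_poly to_ac q"
  by (intro poly_eqI) (simp add: coeff_map_poly coeff_mult to_ac_sum)

lemma poly_to_ac: "poly (map_poly to_ac p) (to_ac x) = to_ac (poly p x)"
  by (induction p) (simp_all add: map_poly_pCons)

text \<open>
  In an algebraic closure \<open>g\<close> is a product of factors \<open>z - x\<close> with \<open>x ^ n = e\<close>, so the \<open>n\<close>-th power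
  of its constant term \<open>\<Prod>(- x)\<close> is known.
\<close>
lemma constant_term_power_of_divisor:
  fixes g :: "'a :: field poly"
  assumes g: "lead_coeff g = 1" "g dvd monom 1 n - [:e:]"
  shows "coeff g 0 ^ n = ((-1) ^ n * e) ^ Polynomial.degree g"
proof -
  let ?g = "map_poly to_ac g"
  from g(2) obtain k where k: "monom 1 n - [:e:] = g * k" by blast
  have deg: "Polynomial.degree ?g = Polynomial.degree g" by (simp add: degree_map_poly)
  have lc: "lead_coeff ?g = 1" using g(1) by (simp add: coeff_map_poly deg)
  hence "?g \<noteq> 0" by auto
  then obtain A where A: "size A = Polynomial.degree ?g"
    "?g = smult (lead_coeff ?g) (\<Prod>x\<in>#A. [:-x, 1:])"
    using alg_closed_imp_factorization by blast
  have g_eq: "?g = (\<Prod>x\<in>#A. [:-x, 1:])" using A(2) lc by simp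
  have root: "(- x) ^ n = to_ac ((-1) ^ n * e)" if "x \<in># A" for x
  proof -
    have "poly ?g x = 0"
      unfolding g_eq poly_prod_mset using that by (auto intro!: image_eqI[of _ _ x])
    moreover have "map_poly to_ac (monom 1 n - [:e:]) = monom 1 n - [:to_ac e:]"
      by (intro poly_eqI) (auto simp: coeff_map_poly coeff_pCons split: nat.splits)
    ultimately have "x ^ n = to_ac e"
      using arg_cong[OF k, of "\<lambda>p. poly (map_poly to_ac p) x"]
      by (simp add: map_poly_to_ac_mult poly_monom)
    thus ?thesis by (simp add: power_minus[of x])
  qed
  have "to_ac (coeff g 0 ^ n) = poly ?g 0 ^ n"
    using poly_to_ac[of g 0] by (simp add: poly_0_coeff_0)
  also have "poly ?g 0 = (\<Prod>x\<in>#A. - x)"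
    unfolding g_eq by (simp add: poly_prod_mset image_mset.compositionality o_def)
  also have "\<dots> ^ n = (\<Prod>x\<in>#A. (- x) ^ n)"
    by (induction A) (simp_all add: power_mult_distrib del: mult_minus_left)
  also have "\<dots> = (\<Prod>x\<in>#A. to_ac ((-1) ^ n * e))"
    by (intro arg_cong[where f = prod_mset] image_mset_cong root)
  also have "\<dots> = to_ac (((-1) ^ n * e) ^ Polynomial.degree g)"
    using A(1) by (simp add: deg)
  finally show ?thesis by (simp only: to_ac_eq_iff)
qed

text \<open>
  If \<open>a\<close> is the constant term of a monic divisor of degree \<open>r\<close>, then \<open>a ^ (2 m) = (- e\<^sup>2) ^ r\<close>.
  Comparing valuations shows that \<open>m\<close> divides \<open>r\<close>, since \<open>w\<close> is coprime to \<open>m\<close>. A proper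
  divisor can thus be taken to have degree \<open>r = m\<close>, and as \<open>m\<close> is odd, \<open>(a / e) ^ m\<close> is then a square root
  of \<open>-1\<close>.
\<close>
lemma irreducible_even_power_plus_square:
  fixes e :: "'a :: field"
  assumes v: "discrete_valuation v" and ns: "\<And>r :: 'a. r\<^sup>2 \<noteq> -1"
    and m: "odd m" and e: "e \<noteq> 0"
    and p: "v p > 0" "\<And>x. x \<noteq> 0 \<Longrightarrow> v p dvd v x"
    and ve: "v e = v p * w" "coprime w (int m)"
  shows "Factorial_Ring.irreducible (monom 1 (2 * m) + [:e\<^sup>2:])"
proof (rule ccontr)
  let ?f = "monom 1 (2 * m) + [:e\<^sup>2:] :: 'a poly"
  assume red: "\<not> Factorial_Ring.irreducible ?f"
  have m0: "m > 0" using m by (auto intro: Nat.gr0I)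
  hence deg: "Polynomial.degree ?f = 2 * m"
    by (subst degree_add_eq_left) (auto simp: degree_monom_eq)
  obtain g where g: "lead_coeff g = 1" "Polynomial.degree g > 0"
    "2 * Polynomial.degree g \<le> Polynomial.degree ?f" "g dvd ?f"
    using reducible_poly_monic_divisor[OF _ red] deg m0 by auto
  define r where "r = Polynomial.degree g"
  define a where "a = coeff g 0"
  have "?f = monom 1 (2 * m) - [:- e\<^sup>2:]" by (intro poly_eqI) (simp add: coeff_pCons split: nat.splits)
  with g(4) have "g dvd monom 1 (2 * m) - [:- e\<^sup>2:]" by simp
  from constant_term_power_of_divisor[OF g(1) this]
  have a: "a ^ (2 * m) = (- e\<^sup>2) ^ r" by (simp add: a_def r_def)
  have "a \<noteq> 0"
  proof
    assume "a = 0"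
    hence "(- e\<^sup>2) ^ r = 0" using a m0 by (metis mult_is_0 neq0_conv power_eq_0_iff zero_neq_numeral)
    moreover have "- e\<^sup>2 \<noteq> 0" using e by simp
    ultimately show False by (metis power_not_zero)
  qed
  have "2 * int m * v a = int r * v (- e\<^sup>2)"
    using arg_cong[OF a, of v] \<open>a \<noteq> 0\<close> e by (simp add: valuation_power[OF v])
  also have "v (- e\<^sup>2) = 2 * v e"
    using e by (simp add: valuation_minus[OF v] valuation_power[OF v])
  finally have "int m * v a = v p * (int r * w)" using ve by simp
  moreover obtain u where "v a = v p * u" using p(2)[OF \<open>a \<noteq> 0\<close>] by auto
  ultimately have "int m * u = int r * w" using p(1) by simp
  hence "int m dvd int r * w" by (metis dvd_triv_left)
  hence "m dvd r" using ve(2) by (simp add: coprime_commute coprime_dvd_mult_left_iff)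
  moreover have "r \<le> m" "r > 0" using g(2,3) deg by (simp_all add: r_def)
  ultimately have "r = m" by (auto dest: dvd_imp_le)
  have "(a ^ m / e ^ m)\<^sup>2 = a ^ (2 * m) / (e\<^sup>2) ^ m"
    by (simp add: power_divide mult.commute flip: power_mult)
  also have "\<dots> = -1" unfolding a \<open>r = m\<close> using m e by (simp add: power_minus_odd)
  finally show False using ns by blast
qed

lemma pcompose_monom: "pcompose (monom c n) q = smult c (q ^ n)"
  by (induction n) (simp_all add: monom_Suc pcompose_pCons monom_0)

lemma sophie_germain_identity:
  fixes A D E :: "'a :: comm_ring_1"
  assumes "D\<^sup>2 = 2 * E"
  shows "A ^ 4 + E\<^sup>2 = (A\<^sup>2 + D * A + E) * (A\<^sup>2 - D * A + E)"
proof -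
  have "(A\<^sup>2 + D * A + E) * (A\<^sup>2 - D * A + E) = (A\<^sup>2 + E)\<^sup>2 - D\<^sup>2 * A\<^sup>2"
    by (simp add: power2_eq_square algebra_simps)
  also have "\<dots> = A ^ 4 + E\<^sup>2"
    unfolding assms by (simp add: power2_eq_square power4_eq_xxxx algebra_simps)
  finally show ?thesis by simp
qed

text \<open>
  With \<open>e = 2 c\<^sup>2\<close> and \<open>i = 1 / (4 c\<^sup>2)\<close>, the polynomial \<open>h = i (z ^ (2 m) + e\<^sup>2)\<close> has the constant
  term \<open>c\<^sup>2 = r\<close>, so that \<open>h - r\<close> is the square of \<open>z ^ m / (2 c)\<close>. Its power with exponent \<open>2 m\<close> is
  the fourth power of \<open>A = (z ^ m / (2 c)) ^ m\<close>, and \<open>h(h - r) = i (A ^ 4 + e\<^sup>2)\<close> factors.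
\<close>
lemma newly_reducible_twice_odd_2:
  fixes v :: "'a :: field \<Rightarrow> int"
  assumes two: "(2 :: 'a) \<noteq> 0" and ns: "\<And>r :: 'a. r\<^sup>2 \<noteq> -1"
    and v: "discrete_valuation v" "nontrivial_valuation v" and m: "odd m"
  obtains f :: "'a :: field poly" where "Polynomial.degree f = 2 * m" "newly_reducible f 2"
proof -
  have m0: "m > 0" using m by (auto intro: Nat.gr0I)
  obtain p where p: "p \<noteq> 0" "v p > 0" "\<And>x. x \<noteq> 0 \<Longrightarrow> v p dvd v x"
    using valuation_image_multiples[OF v] by blast
  obtain k where k: "v 2 = v p * k" using p(3)[OF two] by auto
  from m obtain j where j: "m = 2 * j + 1" by (auto elim: oddE)
  \<comment> \<open>\<open>e = 2 c\<^sup>2\<close> has value \<open>(k + 2 n) v p\<close> for \<open>c = p powi n\<close>. The choice \<open>n = (1 - k) (m + 1) / 2\<close>,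
    an integer because \<open>m\<close> is odd, makes \<open>k + 2 n\<close> congruent to \<open>1\<close> modulo \<open>m\<close>.\<close>
  define c where "c = p powi ((1 - k) * (int j + 1))"
  define e where "e = 2 * c\<^sup>2"
  have c: "c \<noteq> 0" using p by (simp add: c_def)
  have e: "e \<noteq> 0" using c two by (simp add: e_def)
  have ve: "v e = v p * (1 + (1 - k) * int m)"
    using p(1) two c k by (simp add: e_def valuation_mult[OF v(1)] valuation_power[OF v(1)])
      (simp add: c_def valuation_powi[OF v(1)] j algebra_simps)
  have cop: "coprime (1 + (1 - k) * int m) (int m)"
    by (metis add.commute coprime_1_left gcd_add_mult coprime_iff_gcd_eq_1 gcd.commute mult.commute)
  define i where "i = inverse (4 * c\<^sup>2)"
  have four: "(4 :: 'a) \<noteq> 0" using two by (rule four_neq_0)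
  hence i: "i * (4 * c\<^sup>2) = 1" "i \<noteq> 0" using c by (auto simp: i_def)
  let ?p = "monom 1 (2 * m) + [:e\<^sup>2:] :: 'a poly"
  define h where "h = smult i ?p"
  have "Factorial_Ring.irreducible h"
    unfolding h_def irreducible_smult_iff[OF i(2)]
    by (rule irreducible_even_power_plus_square[OF v(1) ns m e p(2,3) ve cop])
  moreover have "\<not> Factorial_Ring.irreducible (pcompose h (h - [:c\<^sup>2:]))"
  proof -
    define A where "A = monom (inverse (2 * c) ^ m) (m * m)"
    have "i * e\<^sup>2 = (i * (4 * c\<^sup>2)) * c\<^sup>2" by (simp add: e_def power2_eq_square)
    hence "i * e\<^sup>2 = c\<^sup>2" by (simp add: i)
    hence "h - [:c\<^sup>2:] = monom i (2 * m)"
      by (simp add: h_def smult_add_right smult_monom)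
    also have "i = inverse (2 * c) ^ 2"
      by (simp only: i_def power_inverse power_mult_distrib) simp
    finally have diff: "h - [:c\<^sup>2:] = monom (inverse (2 * c)) m ^ 2"
      by (simp add: monom_power mult.commute)
    have "pcompose ?p q = q ^ (2 * m) + [:e\<^sup>2:]" for q
      by (simp add: pcompose_add pcompose_monom)
    hence "pcompose h (h - [:c\<^sup>2:]) = smult i ((monom (inverse (2 * c)) m ^ 2) ^ (2 * m) + [:e\<^sup>2:])"
      unfolding diff by (simp add: h_def pcompose_smult)
    also have "(monom (inverse (2 * c)) m ^ 2) ^ (2 * m) = A ^ 4"
      by (simp add: A_def monom_power ac_simps flip: power_mult)
    also have "A ^ 4 + [:e\<^sup>2:] =
      (A\<^sup>2 + smult (2 * c) A + [:e:]) * (A\<^sup>2 - smult (2 * c) A + [:e:])"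
    proof -
      have "smult (2 * c) A = [:2 * c:] * A" "[:e\<^sup>2:] = [:e:]\<^sup>2" "[:2 * c:]\<^sup>2 = 2 * [:e:]"
        by (simp_all add: power2_eq_square e_def numeral_poly)
      thus ?thesis by (simp only: sophie_germain_identity)
    qed
    finally have eq: "pcompose h (h - [:c\<^sup>2:]) =
      smult i ((A\<^sup>2 + smult (2 * c) A + [:e:]) * (A\<^sup>2 - smult (2 * c) A + [:e:]))" .
    have A: "Polynomial.degree A = m * m" "A \<noteq> 0"
      using two c by (auto simp: A_def degree_monom_eq)
    have "Polynomial.degree (A\<^sup>2 + q) = 2 * (m * m)" if "Polynomial.degree q \<le> m * m" for q
    proof -
      have "m * m > 0" using m0 by simp
      hence "Polynomial.degree q < Polynomial.degree (A\<^sup>2)"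
        using that A by (simp add: degree_power_eq del: nat_0_less_mult_iff)
      thus ?thesis using A by (simp add: degree_add_eq_left degree_power_eq)
    qed
    hence pos: "Polynomial.degree (A\<^sup>2 + q) > 0" if "Polynomial.degree q \<le> m * m" for q
      using that m0 by simp
    have "Polynomial.degree (A\<^sup>2 + (smult (2 * c) A + [:e:])) > 0"
      using A by (intro pos degree_add_le) auto
    moreover have "Polynomial.degree (A\<^sup>2 + ([:e:] - smult (2 * c) A)) > 0"
      using A by (intro pos degree_diff_le) auto
    moreover have "A\<^sup>2 + ([:e:] - smult (2 * c) A) = A\<^sup>2 - smult (2 * c) A + [:e:]" by simp
    ultimately have "Polynomial.degree (A\<^sup>2 + smult (2 * c) A + [:e:]) > 0"
         "Polynomial.degree (A\<^sup>2 - smult (2 * c) A + [:e:]) > 0"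
      by (simp_all only: add.assoc)
    thus ?thesis unfolding eq irreducible_smult_iff[OF i(2)] by (rule not_irreducible_mult)
  qed
  ultimately have "newly_reducible (pcompose h [:- c\<^sup>2, 1:]) 2"
    using newly_reducible_translate[where r = "c\<^sup>2" and h = h and n = 0] by (simp add: numeral_2_eq_2)
  moreover have "Polynomial.degree ?p = 2 * m"
    using m0 by (subst degree_add_eq_left) (auto simp: degree_monom_eq)
  hence "Polynomial.degree (pcompose h [:- c\<^sup>2, 1:]) = 2 * m"
    using i by (simp add: degree_pcompose h_def)
  ultimately show thesis using that by blast
qed

section \<open>Fields with newly reducible iterates\<close>

theorem theorem1p3:
  assumes "infinite (UNIV :: 'a :: field set)"
    and "CHAR('a) \<noteq> 2"
  shows "(in_N 2 2 TYPE('a) \<longleftrightarrow> (UNIV :: 'a set) \<noteq> nth_powers 2) \<and>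
         (in_N_infinite 2 2 TYPE('a) \<longleftrightarrow> infinite (UNIV - nth_powers 2 :: 'a set)) \<and>
         (((-1 :: 'a) \<notin> nth_powers 2 \<and>
             (\<exists>v :: 'a \<Rightarrow> int. discrete_valuation v \<and> (5 :: 'a) \<noteq> 0 \<and> odd (v 5))) \<or>
          (number_field TYPE('a) \<and> totally_real TYPE('a) \<and>
             (\<exists>P :: 'a set. primeideal P ring_of_integers \<and> lies_over P 3 \<and> residue_degree P 1))
          \<longrightarrow> in_N_infinite 2 3 TYPE('a)) \<and>
         (CHAR('a) \<noteq> 3 \<and> (2 :: 'a) \<notin> nth_powers 3 \<longrightarrow> in_N_infinite 3 2 TYPE('a)) \<and>
         (CHAR('a) \<noteq> 3 \<and> (3 :: 'a) \<notin> nth_powers 2 \<and> (-3 :: 'a) \<notin> nth_powers 4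
          \<longrightarrow> in_N_infinite 4 2 TYPE('a)) \<and>
         ((-1 :: 'a) \<notin> nth_powers 2 \<and>
            (\<exists>v :: 'a \<Rightarrow> int. discrete_valuation v \<and> nontrivial_valuation v)
          \<longrightarrow> (\<forall>d \<ge> 2. d mod 4 = 2 \<longrightarrow> in_N_infinite d 2 TYPE('a)))"
proof (intro conjI impI allI)
  have two: "(2 :: 'a) \<noteq> 0"
    using prime_neq_CHAR_imp_nonzero[OF two_is_prime_nat assms(2)] by simp
  have "prime (3 :: nat)" by (rule prime_nat_numeral_eq[THEN iffD2]) simp
  hence three: "(3 :: 'a) \<noteq> 0" if "CHAR('a) \<noteq> 3"
    using prime_neq_CHAR_imp_nonzero[of 3] that by simp
  note infiniteI = in_N_infiniteI[OF assms(1)]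

  show ex: "in_N 2 2 TYPE('a) \<longleftrightarrow> (UNIV :: 'a set) \<noteq> nth_powers 2"
  proof
    assume "in_N 2 2 TYPE('a)"
    then obtain f :: "'a poly" where "Polynomial.degree f = 2" "Factorial_Ring.irreducible f"
      by (auto simp: in_N_def newly_reducible_def)
    thus "(UNIV :: 'a set) \<noteq> nth_powers 2" by (rule irreducible_quadratic_imp_nonsquare[OF two])
  next
    assume "(UNIV :: 'a set) \<noteq> nth_powers 2"
    from newly_reducible_2_2[OF assms(1) two this] show "in_N 2 2 TYPE('a)"
      unfolding in_N_def by metis
  qed

  show "in_N_infinite 2 2 TYPE('a) \<longleftrightarrow> infinite (UNIV - nth_powers 2 :: 'a set)"
  proof
    assume "in_N_infinite 2 2 TYPE('a)"
    hence "in_N 2 2 TYPE('a)"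
      unfolding in_N_infinite_def in_N_def by (metis (mono_tags, lifting) Collect_empty_eq finite.emptyI)
    thus "infinite (UNIV - nth_powers 2 :: 'a set)"
      using ex infinite_nonsquares[OF assms(1)] by blast
  next
    assume "infinite (UNIV - nth_powers 2 :: 'a set)"
    hence "(UNIV :: 'a set) \<noteq> nth_powers 2" by (metis Diff_cancel finite.emptyI)
    from newly_reducible_2_2[OF assms(1) two this] show "in_N_infinite 2 2 TYPE('a)"
      by (metis infiniteI order_refl)
  qed

  show "in_N_infinite 2 3 TYPE('a)"
    if "((-1 :: 'a) \<notin> nth_powers 2 \<and>
             (\<exists>v :: 'a \<Rightarrow> int. discrete_valuation v \<and> (5 :: 'a) \<noteq> 0 \<and> odd (v 5))) \<or>
          (number_field TYPE('a) \<and> totally_real TYPE('a) \<and>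
             (\<exists>P :: 'a set. primeideal P ring_of_integers \<and> lies_over P 3 \<and> residue_degree P 1))"
  proof -
    have "(\<forall>r :: 'a. r\<^sup>2 \<noteq> -1) \<and> (\<forall>r :: 'a. r\<^sup>2 \<noteq> 5)"
      using that
    proof (elim disjE conjE exE)
      assume "(-1 :: 'a) \<notin> nth_powers 2"
      moreover fix v :: "'a \<Rightarrow> int"
      assume "discrete_valuation v" "(5 :: 'a) \<noteq> 0" "odd (v 5)"
      ultimately show ?thesis
        using odd_valuation_imp_nonsquare[of v 5] by (metis nth_powers_iff)
    next
      fix P :: "'a set"
      assume "primeideal P ring_of_integers" "lies_over P 3" "residue_degree P 1"
      from prime_over_3_imp_nonsquare[OF this, of "-1"] prime_over_3_imp_nonsquare[OF this, of 5]
      show ?thesis by simp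
    qed
    hence "newly_reducible (pcompose [:4, 0, 1:] [:- 5, 1:] :: 'a poly) 3"
      by (intro newly_reducible_2_3[OF two]) auto
    moreover have "Polynomial.degree (pcompose [:4, 0, 1:] [:- 5, 1:] :: 'a poly) = 2"
      by (simp add: degree_pcompose)
    ultimately show ?thesis by (intro infiniteI) auto
  qed

  show "in_N_infinite 3 2 TYPE('a)" if "CHAR('a) \<noteq> 3 \<and> (2 :: 'a) \<notin> nth_powers 3"
  proof -
    have "r ^ 3 \<noteq> 2" for r :: 'a using that by (metis nth_powers_iff)
    with three that obtain f :: "'a poly" where "Polynomial.degree f = 3" "newly_reducible f 2"
      using newly_reducible_3_2 by metis
    thus ?thesis by (intro infiniteI) auto
  qed

  show "in_N_infinite 4 2 TYPE('a)"
    if "CHAR('a) \<noteq> 3 \<and> (3 :: 'a) \<notin> nth_powers 2 \<and> (-3 :: 'a) \<notin> nth_powers 4"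
  proof -
    have "r ^ 2 \<noteq> 3" "r ^ 4 \<noteq> -3" for r :: 'a using that by (metis nth_powers_iff)+
    then obtain f :: "'a poly" where "Polynomial.degree f = 4" "newly_reducible f 2"
      using newly_reducible_4_2[OF two] by metis
    thus ?thesis by (intro infiniteI) auto
  qed

  show "in_N_infinite d 2 TYPE('a)"
    if hyp: "(-1 :: 'a) \<notin> nth_powers 2 \<and>
            (\<exists>v :: 'a \<Rightarrow> int. discrete_valuation v \<and> nontrivial_valuation v)"
      and d: "2 \<le> d" "d mod 4 = 2" for d
  proof -
    have "r\<^sup>2 \<noteq> -1" for r :: 'a using hyp by (metis nth_powers_iff)
    moreover obtain v :: "'a \<Rightarrow> int" where "discrete_valuation v" "nontrivial_valuation v"
      using hyp by blast
    moreover have "odd (d div 2)" "d = 2 * (d div 2)" using d(2) by presburger+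
    ultimately obtain f :: "'a poly" where "Polynomial.degree f = d" "newly_reducible f 2"
      using newly_reducible_twice_odd_2[OF two] by metis
    thus ?thesis using d(1) by (intro infiniteI) auto
  qed
qed

end
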